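(* Let $\varepsilon\in[0,1]$, let $n,k$ be positive integers, let $M_n$ be a $k\times n$ matrix with entries in $\mathbf{F}_2$, let $\mathcal{C}_n$ be the linear code whose generator matrix is $M_n$, and let $P_{ML}(\mathcal{C}_n,1-\varepsilon)$ be the maximum likelihood decoding error probability (ties being counted as errors) of the code $\mathcal{C}_n$ over the binary erasure channel with erasure probability $1-\varepsilon$. Let $X^n$ be uniformly distributed on $\mathbf{F}_2^n$, let $Z^n$ be the output of the memoryless binary erasure channel with erasure probability $\varepsilon$ with input $X^n$, let $S_n=X^nM_n^T\in\mathbf{F}_2^k$, and let $I(M_n)=I(S_n;Z^n)$. Then $$I(M_n)\le n\,P_{ML}(\mathcal{C}_n,1-\varepsilon).$$
   Context: $\mathbf{F}_2$ is the field with two elements; sequences are row vectors. $I(\cdot;\cdot)$ is mutual information, computed with natural logarithms (base $e$). The binary erasure channel BEC($\delta$) with erasure probability $\delta$ has input alphabet $\mathbf{F}_2$ and output alphabet $\mathbf{F}_2\cup\{?\}$; it outputs the input symbol with probability $1-\delta$ and the erasure symbol $?$ with probability $\delta$; it is used $n$ times independently (memoryless). Thus $(X^n,Z^n)$ is i.i.d. with $P_{XZ}(x,x)=\frac{1-\varepsilon}{2}$, $P_{XZ}(x,?)=\frac{\varepsilon}{2}$ for $x\in\mathbf{F}_2$, whereas the channel used to define $P_{ML}(\mathcal{C}_n,1-\varepsilon)$ outputs the input symbol with probability $\varepsilon$ and $?$ with probability $1-\varepsilon$. Coding: a message $m^k\in\mathbf{F}_2^k$ is encoded as $m^kM_n\in\mathbf{F}_2^n$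 and sent over BEC($1-\varepsilon$). The maximum likelihood decoder outputs the message maximizing the likelihood of the received word; a decoding error occurs whenever the maximizer is not unique (i.e. ties count as errors) or is not the transmitted message. $P_{ML}(\mathcal{C}_n,1-\varepsilon)$ is the probability of a decoding error (it does not depend on the transmitted message). $M_n$ is not assumed to have full rank; if several messages are compatible with the received word, this is an error. *)

theory Defs
  imports "HOL-Probability.Probability" "HOL-Library.Z2"
begin

instance bit :: finite
proof
  have "(UNIV :: bit set) \<subseteq> {0, 1}"
    using bit_not_zero_iff by blast
  then show "finite (UNIV :: bit set)"
    by (rule finite_subset) simp
qed

text \<open>
  The binary field is the type \<^typ>\<open>bit\<close>, and \<^const>\<open>None\<close> is the erasure symbol. A matrix with
  \<open>k\<close> rows and \<open>n\<close> columns has type \<open>bit^'n^'k\<close>, where \<open>k = CARD('k)\<close> and \<open>n = CARD('n)\<close>; the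
  operator \<open>v*\<close> multiplies a row vector by a matrix.
\<close>

definition bec :: "real \<Rightarrow> bit \<Rightarrow> bit option pmf" where
  "bec \<delta> x = map_pmf (\<lambda>e. if e then None else Some x) (bernoulli_pmf \<delta>)"

text \<open>The default value \<^const>\<open>None\<close> below is never used, since the index set is \<^const>\<open>UNIV\<close>.\<close>

definition bec_n :: "real \<Rightarrow> bit^'n \<Rightarrow> ((bit option)^'n) pmf" where
  "bec_n \<delta> x = map_pmf vec_lambda (Pi_pmf UNIV None (\<lambda>i. bec \<delta> (x $ i)))"

definition likelihood :: "bit^'n^'k \<Rightarrow> real \<Rightarrow> (bit option)^'n \<Rightarrow> bit^'k \<Rightarrow> real" where
  "likelihood M \<delta> y m = pmf (bec_n \<delta> (m v* M)) y"

definition ml_messages :: "bit^'n^'k \<Rightarrow> real \<Rightarrow> (bit option)^'n \<Rightarrow> (bit^'k) set" where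
  "ml_messages M \<delta> y = {m. \<forall>m'. likelihood M \<delta> y m' \<le> likelihood M \<delta> y m}"

text \<open>
  Decoding of the transmitted message \<open>m\<close> succeeds only if \<open>m\<close> is the unique maximizer of the
  likelihood; in particular every tie is an error.
\<close>

definition ml_error_prob :: "bit^'n^'k \<Rightarrow> real \<Rightarrow> bit^'k \<Rightarrow> real" where
  "ml_error_prob M \<delta> m = measure_pmf.prob (bec_n \<delta> (m v* M)) {y. ml_messages M \<delta> y \<noteq> {m}}"

text \<open>
  The error probability is taken for a uniformly distributed message. The lemma \<open>P_ML_eq\<close> below
  shows that it coincides with the error probability of each individual message.
\<close>

definition P_ML :: "bit^'n^'k \<Rightarrow> real \<Rightarrow> real" where
  "P_ML M \<delta> = measure_pmf.expectation (pmf_of_set UNIV) (ml_error_prob M \<delta>)"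

definition source_output :: "real \<Rightarrow> ((bit^'n) \<times> ((bit option)^'n)) pmf" where
  "source_output \<epsilon> =
     bind_pmf (pmf_of_set UNIV) (\<lambda>x. map_pmf (\<lambda>z. (x, z)) (bec_n \<epsilon> x))"

text \<open>
  Mutual information in nats. The discrete sigma-algebras on the two finite range types are written
  \<open>count_space UNIV\<close>.
\<close>

definition I_SZ :: "bit^'n^'k \<Rightarrow> real \<Rightarrow> real" where
  "I_SZ M \<epsilon> =
     prob_space.mutual_information (measure_pmf (source_output \<epsilon>)) (exp 1)
       (count_space UNIV) (count_space UNIV) (\<lambda>(x, z). x v* transpose M) (\<lambda>(x, z). z)"

text \<open>
  Translating the codeword by \<open>c\<close> translates the unerased part of the channel output by \<open>c\<close>.
\<close>

definition translate :: "bit^'n \<Rightarrow> (bit option)^'n \<Rightarrow> (bit option)^'n" where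
  "translate c y = (\<chi> i. map_option (\<lambda>b. b + c $ i) (y $ i))"

lemma translate_translate [simp]: "translate c (translate c y) = y"
proof -
  have "(b + d) + d = b" for b d :: bit
    by (cases b; cases d) simp_all
  then have "map_option (\<lambda>b. b + d) (map_option (\<lambda>b. b + d) v) = v" for d :: bit and v
    by (cases v) (simp_all only: option.map)
  then show ?thesis
    by (simp only: translate_def vec_eq_iff vec_lambda_beta simp_thms)
qed

lemma inj_translate: "inj (translate c)"
  by (metis injI translate_translate)

lemma bec_n_translate: "bec_n \<delta> (x + c) = map_pmf (translate c) (bec_n \<delta> x)"
proof -
  have bec: "bec \<delta> (a + d) = map_pmf (map_option (\<lambda>b. b + d)) (bec \<delta> a)" for a d
    unfolding bec_def by (auto simp: pmf.map_comp intro!: map_pmf_cong)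
  have "Pi_pmf UNIV None (\<lambda>i. bec \<delta> ((x + c) $ i)) =
        Pi_pmf UNIV None (\<lambda>i. map_pmf (map_option (\<lambda>b. b + c $ i)) (bec \<delta> (x $ i)))"
    by (simp only: bec vector_add_component)
  also have "\<dots> = map_pmf (\<lambda>f i. map_option (\<lambda>b. b + c $ i) (f i))
        (Pi_pmf UNIV None (\<lambda>i. bec \<delta> (x $ i)))"
    unfolding map_pmf_def
    apply (subst Pi_pmf_bind[where d' = None])
     apply (rule finite)
    apply simp
    done
  finally show ?thesis
    unfolding bec_n_def
    by (simp add: pmf.map_comp o_def translate_def)
qed

lemma likelihood_translate:
  "likelihood M \<delta> (translate (d v* M) y) (m + d) = likelihood M \<delta> y m"
  by (simp only: likelihood_def vector_matrix_left_distrib bec_n_translate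
      pmf_map_inj' inj_translate)

lemma ml_messages_translate:
  "m + d \<in> ml_messages M \<delta> (translate (d v* M) y) \<longleftrightarrow> m \<in> ml_messages M \<delta> y"
proof -
  have "(\<forall>m'. likelihood M \<delta> (translate (d v* M) y) m' \<le> t) \<longleftrightarrow>
        (\<forall>m'. likelihood M \<delta> (translate (d v* M) y) (m' + d) \<le> t)" for t
    by (metis diff_add_cancel)
  then show ?thesis
    by (simp only: ml_messages_def likelihood_translate mem_Collect_eq)
qed

lemma ml_error_prob_eq: "ml_error_prob M \<delta> m = ml_error_prob M \<delta> 0"
proof -
  have iff: "ml_messages M \<delta> (translate (m v* M) y) = {m} \<longleftrightarrow> ml_messages M \<delta> y = {0}" for y
  proof -
    let ?T = "ml_messages M \<delta> (translate (m v* M) y)"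
    have "?T = {m} \<longleftrightarrow> (\<forall>a. a \<in> ?T \<longleftrightarrow> a = m)"
      by blast
    also have "\<dots> \<longleftrightarrow> (\<forall>a. a + m \<in> ?T \<longleftrightarrow> a + m = m)"
      by (metis diff_add_cancel)
    also have "\<dots> \<longleftrightarrow> (\<forall>a. a \<in> ml_messages M \<delta> y \<longleftrightarrow> a = 0)"
      by (simp only: ml_messages_translate add_cancel_left_left)
    also have "\<dots> \<longleftrightarrow> ml_messages M \<delta> y = {0}"
      by blast
    finally show ?thesis .
  qed
  have "bec_n \<delta> (m v* M) = map_pmf (translate (m v* M)) (bec_n \<delta> (0 v* M))"
    using bec_n_translate[of \<delta> "0 v* M" "m v* M"] by (simp only: vector_matrix_mult_0 add_0_left)
  then show ?thesis
    by (simp only: ml_error_prob_def measure_map_pmf vimage_def mem_Collect_eq iff)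
qed

lemma P_ML_eq:
  fixes M :: "bit^'n^'k"
  shows "P_ML M \<delta> = ml_error_prob M \<delta> m"
proof -
  have "ml_error_prob M \<delta> m' = ml_error_prob M \<delta> m" for m'
    using ml_error_prob_eq by metis
  then have "P_ML M \<delta> = measure_pmf.expectation (pmf_of_set UNIV) (\<lambda>_ :: bit^'k. ml_error_prob M \<delta> m)"
    unfolding P_ML_def by (intro Bochner_Integration.integral_cong refl)
  also have "\<dots> = ml_error_prob M \<delta> m"
    by simp
  finally show ?thesis .
qed

end

theory Submission
  imports Defs
begin

text \<open>
  Let \<open>E\<close> be the set of erased positions of \<open>Z\<close>. If no nonzero codeword vanishes on \<open>E\<close>, then the
  columns of \<open>M\<close> indexed by \<open>E\<close> span the whole space, so \<open>S\<close> is uniform both unconditionally and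
  given \<open>Z\<close>, and the information density is \<open>0\<close>. Otherwise it is at most \<open>ln (2 ^ n) \<le> n\<close>, since every
  value attained by \<open>S\<close> has probability at least \<open>2 ^ -n\<close>. Hence the mutual information is at
  most \<open>n\<close> times the probability that a nonzero codeword vanishes on \<open>E\<close>. As \<open>E\<close> has the law of the
  set of unerased positions of the complementary channel, this is the probability that the
  received word does not determine the message there, and then the likelihood has no unique maximizer.
\<close>

section \<open>Erasure patterns and finite mutual information\<close>

text \<open>Quantifying over nonzero messages, not codewords, makes this hold for every
  \<open>E\<close> when \<open>M\<close> is rank-deficient, in line with ties being errors.\<close>

definition vanishing_codeword :: "bit^'n^'k \<Rightarrow> 'n set \<Rightarrow> bool" where
  "vanishing_codeword M E \<longleftrightarrow> (\<exists>m. m \<noteq> 0 \<and> (\<forall>i\<in>E. (m v* M) $ i = 0))"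

text \<open>A pmf is a density for counting measure, and counting measures multiply to counting
  measure on pairs, so the integral formula becomes a finite sum.\<close>

lemma mutual_information_pmf:
  fixes X :: "'a \<Rightarrow> 'b::finite" and Y :: "'a \<Rightarrow> 'c::finite"
  assumes "1 < b"
  shows "prob_space.mutual_information (measure_pmf p) b (count_space UNIV) (count_space UNIV) X Y =
    (\<Sum>w\<in>UNIV. pmf (map_pmf (\<lambda>a. (X a, Y a)) p) w *
       log b (pmf (map_pmf (\<lambda>a. (X a, Y a)) p) w / (pmf (map_pmf X p) (fst w) * pmf (map_pmf Y p) (snd w))))"
proof -
  interpret information_space "measure_pmf p" b
    by unfold_locales (rule assms)
  have distributed: "distributed (measure_pmf p) (count_space UNIV) V (\<lambda>v. ennreal (pmf (map_pmf V p) v))"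
    for V :: "'a \<Rightarrow> 'd"
    by (simp add: distributed_def flip: map_pmf_rep_eq measure_pmf_eq_density)
  have pair: "count_space UNIV \<Otimes>\<^sub>M count_space UNIV = count_space (UNIV :: ('b \<times> 'c) set)"
    by (simp add: pair_measure_count_space)
  have "distributed (measure_pmf p) (count_space UNIV \<Otimes>\<^sub>M count_space UNIV) (\<lambda>a. (X a, Y a))
      (\<lambda>w. ennreal (pmf (map_pmf (\<lambda>a. (X a, Y a)) p) w))"
    unfolding pair by (rule distributed)
  then show ?thesis
    by (subst mutual_information_distr[OF _ _ distributed _ distributed])
      (simp_all add: pair sigma_finite_measure_count_space_finite lebesgue_integral_count_space_finite)
qed

section \<open>Columns spanning the syndrome space\<close>

lemma surj_if_no_left_kernel:
  fixes A :: "'a::field^'n^'m"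
  assumes "\<And>m. m v* A = 0 \<Longrightarrow> m = 0"
  shows "surj ((*v) A)"
proof -
  have "inj ((*v) (transpose A))"
    using assms by (simp add: vec.inj_iff_eq_0)
  then have "\<exists>B. B ** transpose A = mat 1"
    by (simp only: matrix_left_invertible_injective)
  then show ?thesis
    by (simp only: left_invertible_transpose matrix_right_invertible_surjective)
qed

lemma surj_on_supported:
  fixes M :: "bit^'n^'k"
  assumes "\<not> vanishing_codeword M E"
  obtains c where "\<And>i. i \<notin> E \<Longrightarrow> c $ i = 0" "M *v c = t"
proof -
  \<comment> \<open>Columns outside \<open>E\<close> are zeroed rather than deleted, so the type
    does not depend on \<open>E\<close>. Then \<open>A\<close> ignores entries outside
    \<open>E\<close>, and a preimage under \<open>A\<close> may be cut off to
    \<open>E\<close>.\<close>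
  define A where "A = (\<chi> j i. if i \<in> E then M $ j $ i else 0)"
  have "(m v* A) $ i = (if i \<in> E then (m v* M) $ i else 0)" for m i
    by (simp add: A_def vector_matrix_mult_def)
  then have "m = 0" if "m v* A = 0" for m
    using that assms unfolding vanishing_codeword_def vec_eq_iff by (metis zero_index)
  from surj_if_no_left_kernel[OF this] obtain x where x: "A *v x = t"
    by (metis surjE)
  show thesis
  proof (rule that)
    show "(\<chi> i. if i \<in> E then x $ i else 0) $ i = 0" if "i \<notin> E" for i
      using that by simp
    show "M *v (\<chi> i. if i \<in> E then x $ i else 0) = t"
      unfolding x[symmetric]
      by (auto simp: A_def vec_eq_iff matrix_vector_mult_def intro!: sum.cong)
  qed
qed

section \<open>Translations and erasure patterns of the channel\<close>

text \<open>As \<open>c\<close> is supported on the erasures of \<open>z\<close>, the injective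
  translation by \<open>c\<close> fixes \<open>z\<close>.\<close>

lemma pmf_bec_n_add:
  assumes "\<And>i. z $ i \<noteq> None \<Longrightarrow> c $ i = 0"
  shows "pmf (bec_n \<delta> (x + c)) z = pmf (bec_n \<delta> x) z"
proof -
  have "map_option (\<lambda>b. b + c $ i) (z $ i) = z $ i" for i
    using assms[of i] by (cases "z $ i") auto
  then have "translate c z = z"
    by (simp add: translate_def vec_eq_iff)
  then show ?thesis
    by (metis bec_n_translate inj_translate pmf_map_inj')
qed

lemma map_Not_bernoulli_pmf:
  assumes "0 \<le> p" "p \<le> 1"
  shows "map_pmf Not (bernoulli_pmf p) = bernoulli_pmf (1 - p)"
proof (rule pmf_eqI)
  fix b
  have "pmf (map_pmf Not (bernoulli_pmf p)) (\<not> \<not> b) = pmf (bernoulli_pmf p) (\<not> b)"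
    by (rule pmf_map_inj') (auto intro: injI)
  then show "pmf (map_pmf Not (bernoulli_pmf p)) b = pmf (bernoulli_pmf (1 - p)) b"
    using assms by (cases b) simp_all
qed

lemma map_Collect_bec_n:
  "map_pmf (\<lambda>y. {i. f (y $ i)}) (bec_n \<delta> x) =
    map_pmf Collect (Pi_pmf UNIV (f None) (\<lambda>i. map_pmf f (bec \<delta> (x $ i))))"
  unfolding bec_n_def by (subst Pi_pmf_map[where dflt = None]) (simp_all add: pmf.map_comp o_def)

text \<open>On both sides each position joins the random set independently with probability
  \<epsilon>, whatever the input.\<close>

lemma erased_eq_unerased:
  fixes x x' :: "bit^'n"
  assumes "0 \<le> \<epsilon>" "\<epsilon> \<le> 1"
  shows "map_pmf (\<lambda>y. {i. y $ i = None}) (bec_n \<epsilon> x) =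
    map_pmf (\<lambda>y. {i. y $ i \<noteq> None}) (bec_n (1 - \<epsilon>) x')"
proof -
  have "map_pmf (\<lambda>v. v = None) (bec \<epsilon> a) = bernoulli_pmf \<epsilon>" for a
    unfolding bec_def pmf.map_comp o_def by (simp cong: if_cong)
  moreover have "map_pmf (\<lambda>v. v \<noteq> None) (bec (1 - \<epsilon>) a) = bernoulli_pmf \<epsilon>" for a
    using map_Not_bernoulli_pmf[of "1 - \<epsilon>"] assms unfolding bec_def pmf.map_comp o_def
    by (simp cong: if_cong)
  \<comment> \<open>The two predicates send \<open>None\<close> to different defaults; over
    \<open>UNIV\<close> no coordinate takes its default.\<close>
  moreover have "Pi_pmf UNIV True (\<lambda>_::'n. bernoulli_pmf \<epsilon>) = Pi_pmf UNIV False (\<lambda>_. bernoulli_pmf \<epsilon>)"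
    by (rule pmf_eqI) (simp add: pmf_Pi)
  ultimately show ?thesis
    by (simp only: map_Collect_bec_n[where f = "\<lambda>v. v = None"]
        map_Collect_bec_n[where f = "\<lambda>v. v \<noteq> None"] simp_thms)
qed

text \<open>By symmetry, message 0 is sent. A nonzero message whose codeword vanishes on the
  unerased positions is exactly as likely as 0, so 0 is not the unique maximizer.\<close>

lemma prob_vanishing_le_P_ML:
  fixes M :: "bit^'n^'k"
  shows "measure_pmf.prob (bec_n \<delta> 0) {y. vanishing_codeword M {i. y $ i \<noteq> None}} \<le> P_ML M \<delta>"
proof -
  have "ml_messages M \<delta> y \<noteq> {0}" if V: "vanishing_codeword M {i. y $ i \<noteq> None}" for y
  proof -
    obtain m where m: "m \<noteq> 0" "\<And>i. y $ i \<noteq> None \<Longrightarrow> (m v* M) $ i = 0"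
      using V by (auto simp: vanishing_codeword_def)
    from pmf_bec_n_add[of y "m v* M" \<delta> 0] m(2)
    have "likelihood M \<delta> y m = likelihood M \<delta> y 0"
      by (simp add: likelihood_def)
    then have "m \<in> ml_messages M \<delta> y \<longleftrightarrow> 0 \<in> ml_messages M \<delta> y"
      by (simp add: ml_messages_def)
    with m(1) show ?thesis
      by auto
  qed
  then show ?thesis
    unfolding P_ML_eq[of M \<delta> 0] ml_error_prob_def
    by (auto intro!: measure_pmf.finite_measure_mono)
qed

section \<open>Joint law of syndrome and channel output\<close>

definition syndrome_output :: "bit^'n^'k \<Rightarrow> real \<Rightarrow> ((bit^'k) \<times> ((bit option)^'n)) pmf" where
  "syndrome_output M \<epsilon> = map_pmf (\<lambda>(x, z). (M *v x, z)) (source_output \<epsilon>)"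

lemma pmf_syndrome_output:
  fixes M :: "bit^'n^'k"
  shows "pmf (syndrome_output M \<epsilon>) (s, z) =
    (\<Sum>x\<in>UNIV. if M *v x = s then pmf (bec_n \<epsilon> x) z else 0) / CARD(bit^'n)"
proof -
  have "pmf (map_pmf (Pair a) q) (s, z) = (if a = s then pmf q z else 0)"
    for a :: "bit^'k" and q :: "(bit option^'n) pmf"
    by (auto simp: pmf_map_inj' inj_def pmf_map_outside image_iff)
  then show ?thesis
    unfolding syndrome_output_def source_output_def
    by (simp add: map_bind_pmf pmf.map_comp o_def pmf_bind_pmf_of_set)
qed

lemma fst_syndrome_output:
  "map_pmf fst (syndrome_output M \<epsilon>) = map_pmf ((*v) M) (pmf_of_set UNIV)"
  unfolding syndrome_output_def source_output_def
  by (simp add: map_bind_pmf pmf.map_comp o_def map_pmf_const) (simp add: map_pmf_def)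

lemma pmf_fst_syndrome_output:
  fixes M :: "bit^'n^'k"
  shows "pmf (map_pmf fst (syndrome_output M \<epsilon>)) s = (\<Sum>x\<in>UNIV. if M *v x = s then 1 else 0) / CARD(bit^'n)"
  unfolding fst_syndrome_output map_pmf_def[of "(*v) M"]
  by (simp add: pmf_bind_pmf_of_set indicator_def eq_commute of_bool_def)

lemma erased_snd_syndrome_output:
  fixes M :: "bit^'n^'k"
  assumes "0 \<le> \<epsilon>" "\<epsilon> \<le> 1"
  shows "map_pmf (\<lambda>w. {i. snd w $ i = None}) (syndrome_output M \<epsilon>) =
    map_pmf (\<lambda>y. {i. y $ i \<noteq> None}) (bec_n (1 - \<epsilon>) 0)"
  unfolding syndrome_output_def source_output_def
  by (simp add: map_bind_pmf pmf.map_comp o_def erased_eq_unerased[OF assms, where x' = 0])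

text \<open>Adding \<open>c\<close> carries the fibre over \<open>s\<close> bijectively onto the
  fibre over \<open>s + t\<close>.\<close>

lemma sum_translate_syndrome:
  fixes M :: "bit^'n^'k"
  assumes "M *v c = t" "\<And>x. f (x + c) = f x"
  shows "(\<Sum>x\<in>UNIV. if M *v x = s + t then f x else 0) = (\<Sum>x\<in>UNIV. if M *v x = s then f x else (0::real))"
  by (rule sum.reindex_bij_witness[of _ "\<lambda>x. x + c" "\<lambda>x. x - c"])
    (use assms assms(2)[of "_ - c"] in \<open>auto simp: matrix_vector_mult_diff_distrib matrix_vector_right_distrib algebra_simps\<close>)

text \<open>Every \<open>t\<close> is \<open>M *v c\<close> with \<open>c\<close> supported on the
  erasures of \<open>z\<close>. Shifting inputs by \<open>c\<close> shows that the joint mass at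
  \<open>(t, z)\<close> and the mass of \<open>t\<close> are both constant in \<open>t\<close>,
  which forces the factorization.\<close>

lemma syndrome_output_indep:
  fixes M :: "bit^'n^'k"
  assumes "\<not> vanishing_codeword M {i. z $ i = None}"
  shows "pmf (syndrome_output M \<epsilon>) (s, z) =
    pmf (map_pmf fst (syndrome_output M \<epsilon>)) s * pmf (map_pmf snd (syndrome_output M \<epsilon>)) z"
proof -
  let ?J = "syndrome_output M \<epsilon>"
  have J: "pmf ?J (t, z) = pmf ?J (0, z)" and S: "pmf (map_pmf fst ?J) t = pmf (map_pmf fst ?J) 0" for t
  proof -
    obtain c where c: "\<And>i. z $ i \<noteq> None \<Longrightarrow> c $ i = 0" "M *v c = t"
      using surj_on_supported[OF assms, of t] by auto
    show "pmf ?J (t, z) = pmf ?J (0, z)"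
      using sum_translate_syndrome[OF c(2), of "\<lambda>x. pmf (bec_n \<epsilon> x) z" 0] pmf_bec_n_add[OF c(1)] by (simp add: pmf_syndrome_output)
    show "pmf (map_pmf fst ?J) t = pmf (map_pmf fst ?J) 0"
      using sum_translate_syndrome[OF c(2), of "\<lambda>_. 1" 0] by (simp add: pmf_fst_syndrome_output)
  qed
  have "snd -` {z} = range (\<lambda>t :: bit^'k. (t, z))"
    by auto
  then have "pmf (map_pmf snd ?J) z = (\<Sum>t\<in>UNIV. pmf ?J (t, z))"
    by (simp add: pmf_map measure_measure_pmf_finite sum.reindex inj_on_def)
  also have "\<dots> = CARD(bit^'k) * pmf ?J (0, z)"
    by (subst J) simp
  finally have Z: "pmf (map_pmf snd ?J) z = CARD(bit^'k) * pmf ?J (0, z)" .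
  have "1 = (\<Sum>t\<in>UNIV. pmf (map_pmf fst ?J) t)"
    by (rule sum_pmf_eq_1[symmetric]) auto
  also have "\<dots> = CARD(bit^'k) * pmf (map_pmf fst ?J) 0"
    by (subst S) simp
  \<comment> \<open>The inserted factor is the total mass 1 of the uniform syndrome; regrouping
    yields the two marginals.\<close>
  finally have "pmf ?J (0, z) = (CARD(bit^'k) * pmf (map_pmf fst ?J) 0) * pmf ?J (0, z)"
    by simp
  also have "\<dots> = pmf (map_pmf fst ?J) 0 * (CARD(bit^'k) * pmf ?J (0, z))"
    by (simp only: ac_simps)
  finally show ?thesis
    unfolding Z J[of s] S[of s] .
qed

lemma card_bit: "CARD(bit) = 2"
proof -
  have "(UNIV :: bit set) = {0, 1}"
    using bit_not_zero_iff by blast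
  then have "CARD(bit) = card {0, 1 :: bit}"
    by (rule arg_cong)
  then show ?thesis
    by simp
qed

lemma information_density_le:
  fixes M :: "bit^'n^'k" and \<epsilon> :: real
  defines "J \<equiv> syndrome_output M \<epsilon>"
  assumes "pmf J (s, z) > 0"
  shows "ln (pmf J (s, z) / (pmf (map_pmf fst J) s * pmf (map_pmf snd J) z)) \<le> CARD('n)"
proof -
  have "(s, z) \<in> set_pmf J"
    using assms by (simp add: pmf_positive_iff)
  then obtain x where x: "M *v x = s"
    unfolding J_def syndrome_output_def by auto
  have "(1::real) = (\<Sum>x'\<in>{x}. if M *v x' = s then 1 else 0)"
    using x by simp
  also have "\<dots> \<le> (\<Sum>x'\<in>UNIV. if M *v x' = s then 1 else 0)"
    by (rule sum_mono2) auto
  finally have S: "1 / CARD(bit^'n) \<le> pmf (map_pmf fst J) s"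
    unfolding J_def pmf_fst_syndrome_output by (rule divide_right_mono) simp
  have N: "real CARD(bit^'n) = 2 ^ CARD('n)"
    by (simp add: card_bit CARD_vec)
  have Z: "pmf J (s, z) \<le> pmf (map_pmf snd J) z"
    unfolding pmf_map by (subst measure_pmf_single[symmetric]) (rule measure_pmf.finite_measure_mono, auto)
  have Spos: "0 < pmf (map_pmf fst J) s"
    using S by (rule order.strict_trans2[rotated]) (simp add: N)
  have Zpos: "0 < pmf (map_pmf snd J) z"
    using Z assms by linarith
  have "pmf J (s, z) \<le> 1 * pmf (map_pmf snd J) z"
    using Z by simp
  also have "\<dots> \<le> (2 ^ CARD('n) * pmf (map_pmf fst J) s) * pmf (map_pmf snd J) z"
    using S by (intro mult_right_mono) (simp_all add: N field_simps del: CARD_vec)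
  finally have "pmf J (s, z) / (pmf (map_pmf fst J) s * pmf (map_pmf snd J) z) \<le> 2 ^ CARD('n)"
    using Spos Zpos by (simp add: field_simps)
  then have "ln (pmf J (s, z) / (pmf (map_pmf fst J) s * pmf (map_pmf snd J) z)) \<le> ln (2 ^ CARD('n))"
    using Spos Zpos assms by (subst ln_le_cancel_iff) auto
  also have "\<dots> = CARD('n) * ln 2"
    by (simp add: ln_realpow)
  \<comment> \<open>Measuring in nats matters here: \<open>ln 2 < 1\<close>.\<close>
  also have "\<dots> \<le> CARD('n)"
    using ln_2_less_1 by (simp add: mult_left_le)
  finally show ?thesis .
qed

theorem theorem4:
  fixes \<epsilon> :: real
    and M :: "bit ^ 'n ^ 'k"
  assumes "0 \<le> \<epsilon>" and "\<epsilon> \<le> 1"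
  shows "I_SZ M \<epsilon> \<le> real CARD('n) * P_ML M (1 - \<epsilon>)"
proof -
  define J where "J = syndrome_output M \<epsilon>"
  let ?V = "{w. vanishing_codeword M {i. snd w $ i = None}}"
  have J: "map_pmf (\<lambda>a. ((case a of (x, z) \<Rightarrow> x v* transpose M), (case a of (x, z) \<Rightarrow> z))) (source_output \<epsilon>) = J"
    unfolding J_def syndrome_output_def by (intro map_pmf_cong) auto
  have fst: "map_pmf (\<lambda>(x, z). x v* transpose M) (source_output \<epsilon>) = map_pmf fst J"
    and snd: "map_pmf (\<lambda>(x, z). z) (source_output \<epsilon>) = map_pmf snd J"
    unfolding J[symmetric] pmf.map_comp o_def by simp_all
  \<comment> \<open>Terms of mass zero vanish whatever the logarithm; of the others, those in
    \<open>?V\<close> obey the density bound and the rest have ratio 1.\<close>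
  have summand: "pmf J w * ln (pmf J w / (pmf (map_pmf fst J) (fst w) * pmf (map_pmf snd J) (snd w)))
      \<le> CARD('n) * (if w \<in> ?V then pmf J w else 0)" for w
  proof (cases "w \<in> ?V")
    case True
    then show ?thesis
      using information_density_le[of M \<epsilon> "fst w" "snd w"] pmf_nonneg[of J w]
      by (cases "pmf J w = 0") (auto simp: J_def mult.commute intro!: mult_right_mono)
  next
    case False
    then have "pmf J w = pmf (map_pmf fst J) (fst w) * pmf (map_pmf snd J) (snd w)"
      using syndrome_output_indep[of M "snd w" \<epsilon> "fst w"] by (simp add: J_def)
    with False show ?thesis
      by (cases "pmf J w = 0") simp_all
  qed
  have "I_SZ M \<epsilon> = (\<Sum>w\<in>UNIV. pmf J w * ln (pmf J w / (pmf (map_pmf fst J) (fst w) * pmf (map_pmf snd J) (snd w))))"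
    unfolding I_SZ_def by (subst mutual_information_pmf) (simp_all only: J fst snd log_ln one_less_exp_iff zero_less_one)
  also have "\<dots> \<le> (\<Sum>w\<in>UNIV. CARD('n) * (if w \<in> ?V then pmf J w else 0))"
    by (rule sum_mono) (rule summand)
  also have "\<dots> = CARD('n) * measure_pmf.prob J ?V"
    unfolding sum_distrib_left[symmetric] by (subst measure_measure_pmf_finite) (simp_all add: sum.If_cases)
  \<comment> \<open>The event depends only on the erased set, so its law can be exchanged for that
    of the unerased set of the complementary channel.\<close>
  also have "measure_pmf.prob J ?V =
      measure_pmf.prob (map_pmf (\<lambda>w. {i. snd w $ i = None}) J) (Collect (vanishing_codeword M))"
    by (simp add: measure_map_pmf vimage_def)
  also have "\<dots> = measure_pmf.prob (bec_n (1 - \<epsilon>) 0) {y. vanishing_codeword M {i. y $ i \<noteq> None}}"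
    unfolding J_def erased_snd_syndrome_output[OF assms] by (simp add: measure_map_pmf vimage_def)
  also have "CARD('n) * \<dots> \<le> CARD('n) * P_ML M (1 - \<epsilon>)"
    by (rule mult_left_mono[OF prob_vanishing_le_P_ML]) simp
  finally show ?thesis .
qed

end
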